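(* Let $\bar{a}(N)$ denote the number of partitions $\lambda$ of $N$ with at least two parts, no parts of size $1$, and $\lambda_1=\lambda_2$. For every $j\in\mathbb{N}$ and every integer $n\ge 2j+2$, $$PM(2n-j,n-j)-PM(2(n-1)-j,(n-1)-j)=\bar{a}(n+1).$$
   Context: A partition $\lambda=(\lambda_1\ge\cdots\ge\lambda_\ell)$ of $n$ is a finite nonincreasing sequence of positive integers with sum $n$; $\ell(\lambda)$ is its number of parts. The hook length $h_{(i,j)}(\lambda)$ of a cell $(i,j)$ of the Ferrers diagram is the number of cells consisting of the cell itself, the cells to its right in its row and the cells below it in its column. A numerical set is a subset $S\subseteq\mathbb{N}_0$ containing $0$ with finite complement; a numerical semigroup is a numerical set closed under addition. For a partition $\lambda$ let $S_\lambda=\mathbb{N}_0\setminus\{h_{(i,1)}(\lambda):1\le i\le\ell(\lambda)\}$. $PM(n,m)$ is the number of partitions $\lambda$ of $n$ having exactly $m-1$ parts equal to $1$ such that $S_\lambda$ is a numerical semigroup. Here $\mathbb{N}$ is as written in the paper, which applies the case $j=0$. *)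

theory Defs
  imports Complex_Main
begin

definition is_partition :: "nat \<Rightarrow> nat list \<Rightarrow> bool" where
  "is_partition n lam \<longleftrightarrow> sorted_wrt (\<ge>) lam \<and> (\<forall>p\<in>set lam. p > 0) \<and> sum_list lam = n"

text \<open>Cells are 1-indexed as (row, column), whereas list positions are 0-indexed.\<close>

definition ferrers :: "nat list \<Rightarrow> (nat \<times> nat) set" where
  "ferrers lam = {(i, j). 1 \<le> i \<and> i \<le> length lam \<and> 1 \<le> j \<and> j \<le> lam ! (i - 1)}"

definition hook_length :: "nat list \<Rightarrow> nat \<times> nat \<Rightarrow> nat" where
  "hook_length lam = (\<lambda>(i, j). card {(a, b) \<in> ferrers lam. (a = i \<and> b \<ge> j) \<or> (b = j \<and> a \<ge> i)})"

definition numerical_set :: "nat set \<Rightarrow> bool" where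
  "numerical_set S \<longleftrightarrow> 0 \<in> S \<and> finite (UNIV - S)"

definition numerical_semigroup :: "nat set \<Rightarrow> bool" where
  "numerical_semigroup S \<longleftrightarrow> numerical_set S \<and> (\<forall>x\<in>S. \<forall>y\<in>S. x + y \<in> S)"

definition partition_numset :: "nat list \<Rightarrow> nat set" where
  "partition_numset lam = UNIV - {hook_length lam (i, 1) | i. 1 \<le> i \<and> i \<le> length lam}"

text \<open>``Exactly m - 1 parts equal to 1'' is written additively to avoid truncated
  subtraction at m = 0.\<close>

definition PM :: "nat \<Rightarrow> nat \<Rightarrow> nat" where
  "PM n m = card {lam. is_partition n lam \<and> count_list lam 1 + 1 = m \<and>
                       numerical_semigroup (partition_numset lam)}"

definition abar :: "nat \<Rightarrow> nat" where
  "abar N = card {lam. is_partition N lam \<and> length lam \<ge> 2 \<and> 1 \<notin> set lam \<and> lam ! 0 = lam ! 1}"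

lemma finite_partitions: "finite {lam. is_partition n lam}"
proof (rule finite_subset)
  have "length lam \<le> sum_list lam" if "\<forall>p\<in>set lam. p > 0" for lam :: "nat list"
    using that by (induction lam) auto
  then show "{lam. is_partition n lam} \<subseteq> {lam. set lam \<subseteq> {..n} \<and> length lam \<le> n}"
    using member_le_sum_list by (fastforce simp: is_partition_def)
  show "finite {lam. set lam \<subseteq> {..n} \<and> length lam \<le> n}"
    by (rule finite_lists_length_le) simp
qed

end

theory Submission
  imports Defs
begin

text \<open>
  Write a partition with exactly \<open>k\<close> ones as \<open>\<mu> @ 1\<dots>1\<close>, where \<open>\<mu> = p # \<nu>\<close> is a partition of
  \<open>n \<le> 2 k + 2\<close> without ones. The largest gap of its numerical set is the hook length
  \<open>h = p + \<ell>(\<nu>) + k\<close> of the corner. All other gaps are less than \<open>2 k + 2\<close>, whereas all nonzero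
  elements exceed \<open>k\<close>, so adjoining \<open>h\<close> to the numerical set always yields a semigroup. Hence
  the numerical set itself is a semigroup if and only if \<open>h\<close> is not a sum of two nonzero
  elements; translating by \<open>k\<close>, if and only if \<open>p + \<ell>(\<nu>) - k\<close> is not a sum of two nonzero
  elements of \<open>S\<^sub>\<nu>\<close>. This condition is invariant under \<open>(p, k) \<mapsto> (p + 1, k + 1)\<close>. The partitions
  of \<open>n + 1\<close> without ones that are not obtained by incrementing the first part of one of \<open>n\<close> are
  those with \<open>\<mu>\<^sub>1 = \<mu>\<^sub>2\<close>, and for these \<open>p + \<ell>(\<nu>) - (k + 1) < 2\<close>, so that the condition always
  holds.
\<close>

definition decomposable :: "nat set \<Rightarrow> nat \<Rightarrow> bool" where
  "decomposable S g \<longleftrightarrow> (\<exists>x\<in>S. \<exists>y\<in>S. 0 < x \<and> 0 < y \<and> x + y = g)"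

lemma decomposable_ge_2: "decomposable S g \<Longrightarrow> 2 \<le> g"
  by (auto simp: decomposable_def)

lemma numerical_semigroup_remove_iff:
  assumes S: "numerical_semigroup S" and "0 < h"
  shows "numerical_semigroup (S - {h}) \<longleftrightarrow> \<not> decomposable S h"
proof
  assume semigroup: "numerical_semigroup (S - {h})"
  show "\<not> decomposable S h"
  proof
    assume "decomposable S h"
    then obtain x y where "x \<in> S" "y \<in> S" "0 < x" "0 < y" and sum: "x + y = h"
      by (auto simp: decomposable_def)
    then have "x \<in> S - {h}" "y \<in> S - {h}" by auto
    then have "h \<in> S - {h}"
      using semigroup sum unfolding numerical_semigroup_def by blast
    then show False by simp
  qed
next
  assume indecomposable: "\<not> decomposable S h"
  have "x + y \<noteq> h" if "x \<in> S - {h}" "y \<in> S - {h}" for x y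
    using that indecomposable by (cases "x = 0 \<or> y = 0") (auto simp: decomposable_def)
  moreover have "UNIV - (S - {h}) \<subseteq> insert h (UNIV - S)" by blast
  ultimately show "numerical_semigroup (S - {h})"
    using S \<open>0 < h\<close> unfolding numerical_semigroup_def numerical_set_def
    by (auto intro: finite_subset)
qed

lemma numerical_semigroupI_gaps_less_double:
  assumes zero: "0 \<in> S" and ge: "\<And>x. x \<in> S \<Longrightarrow> 0 < x \<Longrightarrow> m \<le> x"
    and gaps: "\<And>g. g \<notin> S \<Longrightarrow> g < 2 * m"
  shows "numerical_semigroup S"
proof -
  have "x + y \<in> S" if "x \<in> S" "y \<in> S" for x y
  proof (cases "x = 0 \<or> y = 0")
    case False
    then have "2 * m \<le> x + y" using that ge[of x] ge[of y] by simp
    then show ?thesis using gaps[of "x + y"] by linarith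
  qed (use that in auto)
  moreover have "UNIV - S \<subseteq> {..<2 * m}"
    using gaps by blast
  ultimately show ?thesis
    using zero unfolding numerical_semigroup_def numerical_set_def
    by (auto intro: finite_subset)
qed

text \<open>Truncation of \<open>g - k\<close> is harmless, because \<open>0\<close> is not decomposable.\<close>

lemma decomposable_shift:
  "decomposable (insert 0 ((+) k ` (S - {0}))) (k + g) \<longleftrightarrow> decomposable S (g - k)"
proof
  assume "decomposable (insert 0 ((+) k ` (S - {0}))) (k + g)"
  then obtain u v where "u \<in> (+) k ` (S - {0})" "v \<in> (+) k ` (S - {0})" and uv: "u + v = k + g"
    unfolding decomposable_def by blast
  then obtain x y where "x \<in> S" "y \<in> S" "0 < x" "0 < y" and "u = k + x" "v = k + y"
    by auto
  moreover from this uv have "x + y = g - k" by simp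
  ultimately show "decomposable S (g - k)"
    unfolding decomposable_def by blast
next
  assume "decomposable S (g - k)"
  then obtain x y where "x \<in> S" "y \<in> S" "0 < x" "0 < y" "x + y = g - k"
    by (auto simp: decomposable_def)
  then have "k + x \<in> (+) k ` (S - {0})" "k + y \<in> (+) k ` (S - {0})"
    "0 < k + x" "0 < k + y" "(k + x) + (k + y) = k + g"
    by auto
  then show "decomposable (insert 0 ((+) k ` (S - {0}))) (k + g)"
    unfolding decomposable_def by blast
qed

lemma hook_length_first_column:
  assumes "\<forall>p\<in>set lam. 0 < p" "i < length lam"
  shows "hook_length lam (Suc i, 1) = lam ! i + (length lam - Suc i)"
proof -
  have pos: "0 < lam ! a" if "a < length lam" for a
    using assms(1) that by simp
  have "{(a, b) \<in> ferrers lam. (a = Suc i \<and> b \<ge> 1) \<or> (b = 1 \<and> a \<ge> Suc i)} =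
      {Suc i} \<times> {1..lam ! i} \<union> {Suc (Suc i)..length lam} \<times> {1}" (is "?hook = ?arm \<union> ?leg")
  proof (rule set_eqI)
    fix c :: "nat \<times> nat"
    obtain a b where c: "c = (a, b)" by fastforce
    show "c \<in> ?hook \<longleftrightarrow> c \<in> ?arm \<union> ?leg"
      using assms(2) pos[of "a - 1"] pos[of i] unfolding c ferrers_def
      by (cases "a = Suc i") (auto simp: Suc_le_eq)
  qed
  moreover have "card (?arm \<union> ?leg) = lam ! i + (length lam - Suc i)"
    by (subst card_Un_disjoint) (auto simp: card_cartesian_product)
  ultimately show ?thesis
    unfolding hook_length_def by simp
qed

lemma partition_numset_conv_nth:
  assumes "\<forall>p\<in>set lam. 0 < p"
  shows "partition_numset lam = - (\<lambda>i. lam ! i + (length lam - Suc i)) ` {..<length lam}"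
proof -
  have "{hook_length lam (i, 1) | i. 1 \<le> i \<and> i \<le> length lam} =
      (\<lambda>i. hook_length lam (i, 1)) ` Suc ` {..<length lam}"
    by (auto simp: image_Suc_lessThan)
  also have "\<dots> = (\<lambda>i. lam ! i + (length lam - Suc i)) ` {..<length lam}"
    unfolding image_image using hook_length_first_column[OF assms] by (intro image_cong) auto
  finally show ?thesis
    by (auto simp: partition_numset_def)
qed

lemma partition_numset_Nil: "partition_numset [] = UNIV"
  by (simp add: partition_numset_def)

lemma partition_numset_Cons:
  assumes "\<forall>q\<in>set (p # \<nu>). 0 < q"
  shows "partition_numset (p # \<nu>) = partition_numset \<nu> - {p + length \<nu>}"
  using assms by (auto simp: partition_numset_conv_nth lessThan_Suc_eq_insert_0 image_image)

lemma partition_numset_Cons_append_ones: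
  assumes "\<forall>q\<in>set (p # \<nu>). 0 < q"
  shows "partition_numset ((p # \<nu>) @ replicate k 1) =
    partition_numset (\<nu> @ replicate k 1) - {k + (p + length \<nu>)}"
proof -
  have "\<forall>q\<in>set (p # \<nu> @ replicate k 1). 0 < q"
    using assms by auto
  from partition_numset_Cons[OF this] show ?thesis
    by (simp add: add_ac)
qed

lemma partition_numset_append_ones:
  assumes "\<forall>p\<in>set \<nu>. 0 < p"
  shows "partition_numset (\<nu> @ replicate k 1) = insert 0 ((+) k ` (partition_numset \<nu> - {0}))"
  using assms
proof (induction \<nu>)
  case Nil
  have "partition_numset (replicate k 1) = - {1..k}"
    by (induction k) (auto simp: partition_numset_Nil partition_numset_Cons)
  also have "\<dots> = insert 0 ((+) k ` (UNIV - {0}))"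
  proof (rule set_eqI)
    fix x :: nat
    show "x \<in> - {1..k} \<longleftrightarrow> x \<in> insert 0 ((+) k ` (UNIV - {0}))"
      by (auto intro: image_eqI[of _ _ "x - k"])
  qed
  finally show ?case
    by (simp add: partition_numset_Nil)
next
  case (Cons p \<nu>)
  show ?case
    unfolding partition_numset_Cons_append_ones[OF Cons.prems] partition_numset_Cons[OF Cons.prems]
    using Cons by auto
qed

definition one_free_partitions :: "nat \<Rightarrow> nat list set" where
  "one_free_partitions N = {\<mu>. is_partition N \<mu> \<and> 1 \<notin> set \<mu>}"

lemma one_free_partitions_iff:
  "\<mu> \<in> one_free_partitions N \<longleftrightarrow>
    sorted_wrt (\<ge>) \<mu> \<and> (\<forall>q\<in>set \<mu>. 2 \<le> q) \<and> sum_list \<mu> = N"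
proof -
  have "0 < q \<and> q \<noteq> 1 \<longleftrightarrow> 2 \<le> q" for q :: nat by auto
  then show ?thesis
    unfolding one_free_partitions_def is_partition_def mem_Collect_eq by metis
qed

lemma one_free_partition_pos:
  "\<mu> \<in> one_free_partitions N \<Longrightarrow> \<forall>q\<in>set \<mu>. 0 < q"
  by (simp add: one_free_partitions_def is_partition_def)

lemma finite_one_free_partitions: "finite (one_free_partitions N)"
  by (rule finite_subset[OF _ finite_partitions[of N]]) (auto simp: one_free_partitions_def)

lemma one_free_partition_Cons:
  assumes "\<mu> \<in> one_free_partitions N" "0 < N"
  obtains p \<nu> where "\<mu> = p # \<nu>"
  using assms by (cases \<mu>) (auto simp: one_free_partitions_iff)

lemma double_length_le_sum_list:
  assumes "\<forall>x\<in>set xs. 2 \<le> (x::nat)"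
  shows "2 * length xs \<le> sum_list xs"
  using assms by (induction xs) auto

lemma double_gap_le_sum_list:
  assumes "p # \<nu> \<in> one_free_partitions N" "g \<notin> partition_numset \<nu>"
  shows "2 * g \<le> N"
  using assms
proof (induction \<nu> arbitrary: N)
  case Nil
  then show ?case by (simp add: partition_numset_Nil)
next
  case (Cons q \<nu>)
  have ge_2: "\<forall>r\<in>set \<nu>. 2 \<le> r" and "q \<le> p" and N: "N = p + q + sum_list \<nu>"
    using Cons.prems(1) by (auto simp: one_free_partitions_iff)
  have "g = q + length \<nu> \<or> g \<notin> partition_numset \<nu>"
    using Cons.prems one_free_partition_pos[OF Cons.prems(1)] by (auto simp: partition_numset_Cons)
  then show ?case
  proof
    assume "g = q + length \<nu>"
    then show ?thesis
      using \<open>q \<le> p\<close> N double_length_le_sum_list[OF ge_2] by simp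
  next
    assume "g \<notin> partition_numset \<nu>"
    moreover have "p # \<nu> \<in> one_free_partitions (p + sum_list \<nu>)"
      using Cons.prems(1) by (auto simp: one_free_partitions_iff)
    ultimately show ?thesis
      using Cons.IH N by fastforce
  qed
qed

lemma numerical_semigroup_tl_append_ones:
  assumes "p # \<nu> \<in> one_free_partitions N" "N \<le> 2 * k + 2"
  shows "numerical_semigroup (partition_numset (\<nu> @ replicate k 1))"
proof (rule numerical_semigroupI_gaps_less_double[where m = "Suc k"])
  have pos: "\<forall>q\<in>set \<nu>. 0 < q"
    using one_free_partition_pos[OF assms(1)] by simp
  note numset = partition_numset_append_ones[OF pos, of k]
  show "0 \<in> partition_numset (\<nu> @ replicate k 1)"
    unfolding numset by simp
  show "Suc k \<le> x" if "x \<in> partition_numset (\<nu> @ replicate k 1)" "0 < x" for x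
    using that unfolding numset by auto
  show "g < 2 * Suc k" if "g \<notin> partition_numset (\<nu> @ replicate k 1)" for g
  proof (cases "g \<le> k")
    case False
    then have "g - k \<notin> partition_numset \<nu>"
      using that unfolding numset by (auto simp: image_iff dest: bspec[of _ _ "g - k"])
    with assms(1) have "2 * (g - k) \<le> N"
      by (rule double_gap_le_sum_list)
    then show ?thesis using assms(2) by simp
  qed simp
qed

lemma numerical_semigroup_append_ones_iff:
  assumes "p # \<nu> \<in> one_free_partitions N" "N \<le> 2 * k + 2"
  shows "numerical_semigroup (partition_numset ((p # \<nu>) @ replicate k 1)) \<longleftrightarrow>
    \<not> decomposable (partition_numset \<nu>) (p + length \<nu> - k)"
proof -
  have pos: "\<forall>q\<in>set (p # \<nu>). 0 < q"
    using assms(1) by (rule one_free_partition_pos)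
  have "partition_numset ((p # \<nu>) @ replicate k 1) =
      partition_numset (\<nu> @ replicate k 1) - {k + (p + length \<nu>)}"
    using pos by (rule partition_numset_Cons_append_ones)
  also have "numerical_semigroup \<dots> \<longleftrightarrow>
      \<not> decomposable (partition_numset (\<nu> @ replicate k 1)) (k + (p + length \<nu>))"
    using numerical_semigroup_tl_append_ones[OF assms] pos
    by (intro numerical_semigroup_remove_iff) auto
  also have "\<dots> \<longleftrightarrow> \<not> decomposable (partition_numset \<nu>) (p + length \<nu> - k)"
    using pos by (subst partition_numset_append_ones) (auto simp: decomposable_shift)
  finally show ?thesis .
qed

lemma filter_neq_append_replicate_min:
  fixes b :: "'a :: linorder"
  assumes "sorted_wrt (\<ge>) xs" "\<forall>x\<in>set xs. b \<le> x"
  shows "filter (\<lambda>x. x \<noteq> b) xs @ replicate (count_list xs b) b = xs"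
  using assms
proof (induction xs)
  case (Cons x xs)
  show ?case
  proof (cases "x = b")
    case True
    then have "\<forall>y\<in>set xs. y = b"
      using Cons.prems by (auto intro: antisym)
    then have "filter (\<lambda>y. y \<noteq> b) xs = []" by simp
    then show ?thesis
      using Cons True by simp
  qed (use Cons in simp)
qed simp

lemma partitions_with_ones_eq:
  "{lam. is_partition (N + k) lam \<and> count_list lam 1 = k} =
    (\<lambda>\<mu>. \<mu> @ replicate k 1) ` one_free_partitions N"
proof (intro equalityI subsetI)
  fix lam assume lam: "lam \<in> {lam. is_partition (N + k) lam \<and> count_list lam 1 = k}"
  let ?\<mu> = "filter (\<lambda>p. p \<noteq> 1) lam"
  have decomp: "lam = ?\<mu> @ replicate k 1"
    using lam filter_neq_append_replicate_min[of lam 1] by (auto simp: is_partition_def Suc_le_eq)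
  then have "sum_list (?\<mu> @ replicate k 1) = N + k"
    using lam by (simp only: is_partition_def mem_Collect_eq)
  then have "?\<mu> \<in> one_free_partitions N"
    using lam
    by (auto simp: one_free_partitions_def is_partition_def sorted_wrt_filter sum_list_replicate)
  then show "lam \<in> (\<lambda>\<mu>. \<mu> @ replicate k 1) ` one_free_partitions N"
    using decomp by (rule rev_image_eqI)
next
  fix lam assume "lam \<in> (\<lambda>\<mu>. \<mu> @ replicate k 1) ` one_free_partitions N"
  moreover have "sorted_wrt (\<ge>) (replicate k (1::nat))" "count_list (replicate k (1::nat)) 1 = k"
    by (induction k) auto
  ultimately show "lam \<in> {lam. is_partition (N + k) lam \<and> count_list lam 1 = k}"
    by (auto simp: one_free_partitions_def is_partition_def sorted_wrt_append sum_list_replicate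
        Suc_le_eq count_list_0_iff)
qed

definition semigroup_stems :: "nat \<Rightarrow> nat \<Rightarrow> nat list set" where
  "semigroup_stems N k =
     {\<mu> \<in> one_free_partitions N. numerical_semigroup (partition_numset (\<mu> @ replicate k 1))}"

lemma PM_eq_card_semigroup_stems: "PM (N + k) (Suc k) = card (semigroup_stems N k)"
proof -
  have "{lam. is_partition (N + k) lam \<and> count_list lam 1 + 1 = Suc k \<and>
          numerical_semigroup (partition_numset lam)} =
      {lam. is_partition (N + k) lam \<and> count_list lam 1 = k} \<inter>
        {lam. numerical_semigroup (partition_numset lam)}"
    by auto
  also have "\<dots> = (\<lambda>\<mu>. \<mu> @ replicate k 1) ` semigroup_stems N k"
    unfolding partitions_with_ones_eq semigroup_stems_def by auto
  finally show ?thesis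
    unfolding PM_def by (simp add: card_image inj_on_def)
qed

definition flat_partitions :: "nat \<Rightarrow> nat list set" where
  "flat_partitions N = {\<mu> \<in> one_free_partitions N. 2 \<le> length \<mu> \<and> \<mu> ! 0 = \<mu> ! 1}"

lemma abar_eq_card_flat_partitions: "abar N = card (flat_partitions N)"
  unfolding abar_def flat_partitions_def one_free_partitions_def
  by (rule arg_cong[where f = card]) auto

lemma flat_partition_Cons_Cons:
  assumes "\<mu> \<in> flat_partitions N"
  obtains p \<nu> where "\<mu> = p # p # \<nu>"
  using assms by (auto simp: flat_partitions_def numeral_2_eq_2 Suc_le_length_iff)

lemma flat_partitions_subset_semigroup_stems:
  assumes "N \<le> 2 * k + 1"
  shows "flat_partitions N \<subseteq> semigroup_stems N k"
proof
  fix \<mu> assume \<mu>: "\<mu> \<in> flat_partitions N"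
  then obtain p \<nu> where eq: "\<mu> = p # p # \<nu>"
    by (rule flat_partition_Cons_Cons)
  have one_free: "p # p # \<nu> \<in> one_free_partitions N"
    using \<mu> by (simp add: flat_partitions_def eq)
  then have "\<forall>q\<in>set \<nu>. 2 \<le> q" "2 * p + sum_list \<nu> = N"
    by (auto simp: one_free_partitions_iff)
  then have "p + length (p # \<nu>) - k < 2"
    using double_length_le_sum_list[of \<nu>] assms by simp
  then have "\<not> decomposable (partition_numset (p # \<nu>)) (p + length (p # \<nu>) - k)"
    using decomposable_ge_2 linorder_not_le by blast
  then show "\<mu> \<in> semigroup_stems N k"
    using one_free assms numerical_semigroup_append_ones_iff[of p "p # \<nu>" N k]
    by (simp add: semigroup_stems_def eq)
qed

primrec inc_hd :: "nat list \<Rightarrow> nat list" where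
  "inc_hd [] = []"
| "inc_hd (p # \<nu>) = Suc p # \<nu>"

lemma inj_inc_hd: "inj inc_hd"
proof (rule injI)
  fix xs ys assume "inc_hd xs = inc_hd ys"
  then show "xs = ys" by (cases xs; cases ys) auto
qed

lemma inc_hd_in_one_free_partitions:
  assumes "\<mu> \<in> one_free_partitions N" "0 < N"
  shows "inc_hd \<mu> \<in> one_free_partitions (Suc N)"
  using assms by (cases \<mu>) (fastforce simp: one_free_partitions_iff)+

lemma inc_hd_notin_flat_partitions:
  assumes "\<mu> \<in> one_free_partitions N"
  shows "inc_hd \<mu> \<notin> flat_partitions N'"
proof
  assume "inc_hd \<mu> \<in> flat_partitions N'"
  then obtain p \<nu> where "inc_hd \<mu> = p # p # \<nu>"
    by (rule flat_partition_Cons_Cons)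
  then show False
    using assms by (cases \<mu>) (auto simp: one_free_partitions_iff)
qed

lemma one_free_partitions_Suc:
  assumes "2 \<le> N"
  shows "one_free_partitions (Suc N) = inc_hd ` one_free_partitions N \<union> flat_partitions (Suc N)"
proof (intro equalityI subsetI)
  fix \<mu> assume \<mu>: "\<mu> \<in> one_free_partitions (Suc N)"
  then obtain p \<nu> where eq: "\<mu> = p # \<nu>"
    by (rule one_free_partition_Cons) simp
  have sorted: "sorted_wrt (\<ge>) (p # \<nu>)" and ge_2: "\<forall>q\<in>set (p # \<nu>). 2 \<le> q"
    and sum: "p + sum_list \<nu> = Suc N"
    using \<mu> by (auto simp: one_free_partitions_iff eq)
  show "\<mu> \<in> inc_hd ` one_free_partitions N \<union> flat_partitions (Suc N)"
  proof (cases "\<nu> \<noteq> [] \<and> hd \<nu> = p")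
    case True
    then have "\<mu> \<in> flat_partitions (Suc N)"
      using \<mu> eq by (cases \<nu>) (auto simp: flat_partitions_def)
    then show ?thesis ..
  next
    case False
    then have "\<forall>q\<in>set \<nu>. q < p" "3 \<le> p"
      using sorted ge_2 sum assms by (cases \<nu>; force)+
    then have "(p - 1) # \<nu> \<in> one_free_partitions N" "\<mu> = inc_hd ((p - 1) # \<nu>)"
      using sorted ge_2 sum eq by (force simp: one_free_partitions_iff)+
    then show ?thesis by blast
  qed
qed (use assms in \<open>auto simp: flat_partitions_def intro: inc_hd_in_one_free_partitions\<close>)

lemma inc_hd_in_semigroup_stems_iff:
  assumes \<mu>: "\<mu> \<in> one_free_partitions N" and N: "0 < N" "N \<le> 2 * k + 2"
  shows "inc_hd \<mu> \<in> semigroup_stems (Suc N) (Suc k) \<longleftrightarrow> \<mu> \<in> semigroup_stems N k"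
proof -
  obtain p \<nu> where eq: "\<mu> = p # \<nu>"
    using \<mu> N(1) by (rule one_free_partition_Cons)
  have "Suc p # \<nu> \<in> one_free_partitions (Suc N)"
    using inc_hd_in_one_free_partitions[OF \<mu> N(1)] by (simp add: eq)
  then show ?thesis
    using \<mu> N numerical_semigroup_append_ones_iff[of p \<nu> N k]
      numerical_semigroup_append_ones_iff[of "Suc p" \<nu> "Suc N" "Suc k"]
    by (simp add: semigroup_stems_def eq)
qed

lemma semigroup_stems_Suc:
  assumes "2 \<le> N" "N \<le> 2 * k + 2"
  shows "semigroup_stems (Suc N) (Suc k) = inc_hd ` semigroup_stems N k \<union> flat_partitions (Suc N)"
proof -
  have "semigroup_stems (Suc N) (Suc k) =
      one_free_partitions (Suc N) \<inter> semigroup_stems (Suc N) (Suc k)"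
    by (auto simp: semigroup_stems_def)
  also have "\<dots> = inc_hd ` one_free_partitions N \<inter> semigroup_stems (Suc N) (Suc k) \<union>
      flat_partitions (Suc N) \<inter> semigroup_stems (Suc N) (Suc k)"
    unfolding one_free_partitions_Suc[OF assms(1)] by (rule Int_Un_distrib2)
  also have "inc_hd ` one_free_partitions N \<inter> semigroup_stems (Suc N) (Suc k) =
      inc_hd ` semigroup_stems N k"
    using inc_hd_in_semigroup_stems_iff[of _ N k] assms by (auto simp: semigroup_stems_def)
  also have "flat_partitions (Suc N) \<inter> semigroup_stems (Suc N) (Suc k) = flat_partitions (Suc N)"
    using flat_partitions_subset_semigroup_stems[of "Suc N" "Suc k"] assms(2) by auto
  finally show ?thesis .
qed

lemma PM_Suc:
  assumes "2 \<le> N" "N \<le> 2 * k + 2"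
  shows "PM (Suc N + Suc k) (Suc (Suc k)) = PM (N + k) (Suc k) + abar (Suc N)"
proof -
  have stems: "semigroup_stems N k \<subseteq> one_free_partitions N"
    and flat: "flat_partitions (Suc N) \<subseteq> one_free_partitions (Suc N)"
    by (auto simp: semigroup_stems_def flat_partitions_def)
  have "inc_hd ` semigroup_stems N k \<inter> flat_partitions (Suc N) = {}"
    using inc_hd_notin_flat_partitions stems by blast
  then have "card (semigroup_stems (Suc N) (Suc k)) =
      card (inc_hd ` semigroup_stems N k) + card (flat_partitions (Suc N))"
    unfolding semigroup_stems_Suc[OF assms]
    using finite_subset[OF stems] finite_subset[OF flat]
    by (intro card_Un_disjoint) (auto simp: finite_one_free_partitions)
  then show ?thesis
    unfolding PM_eq_card_semigroup_stems abar_eq_card_flat_partitions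
    by (simp add: card_image inj_on_subset[OF inj_inc_hd])
qed

theorem theorem5p5:
  fixes j n :: nat
  assumes "n \<ge> 2 * j + 2"
  shows "int (PM (2 * n - j) (n - j)) - int (PM (2 * (n - 1) - j) ((n - 1) - j)) = int (abar (n + 1))"
proof -
  define k where "k = n - j - 2"
  have "2 * n - j = Suc n + Suc k" "n - j = Suc (Suc k)"
    "2 * (n - 1) - j = n + k" "(n - 1) - j = Suc k" "2 \<le> n" "n \<le> 2 * k + 2"
    using assms by (auto simp: k_def)
  then show ?thesis
    using PM_Suc[of n k] by simp
qed

end
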